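(* Let $m\ge1$ and let $\Lambda=(\lambda_1,\ldots,\lambda_n)\subset\mathbb{R}^{4m}$ be an admissible configuration whose affine span is $\mathbb{R}^{4m}$. For $J\subset\{1,\ldots,n\}$ put $F_J=P_\Lambda\cap\{x_j=0: j\in J\}$. Then the relative interior of $F_J$ is nonempty if and only if $$0\in\operatorname{relint}\operatorname{conv}\{\lambda_i:i\notin J\}.$$
   Context: A configuration $\Lambda=(\lambda_1,\ldots,\lambda_n)\subset\mathbb{R}^{4m}$ is admissible if $0\in\operatorname{conv}\{\lambda_1,\ldots,\lambda_n\}$ and, for every $I\subset\{1,\ldots,n\}$, $0\in\operatorname{conv}\{\lambda_i:i\in I\}$ implies $|I|>4m$. The set $P_\Lambda$ is $$P_\Lambda=\Big\{x\in\mathbb{R}_{\ge0}^n:\ \sum_i\lambda_ix_i=0,\ \sum_ix_i=1\Big\}.$$ $\operatorname{relint}$ denotes the relative interior of a convex set in its affine span (the relative interior of the empty set is empty). *)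

theory Defs
  imports "HOL-Analysis.Analysis"
begin

text \<open>
  The points of a configuration are indexed by a finite type \<open>'n\<close>, in the role of
  \<open>{1, \<dots>, n}\<close>, so repeated points count separately. The ambient space is
  \<open>real ^ 'd\<close>; the dimension bound \<open>4m\<close> in admissibility is \<open>CARD('d)\<close>.
\<close>

definition admissible :: "('n::finite \<Rightarrow> real ^ 'd::finite) \<Rightarrow> bool" where
  "admissible \<Lambda> \<longleftrightarrow>
     0 \<in> convex hull (range \<Lambda>) \<and>
     (\<forall>I. 0 \<in> convex hull (\<Lambda> ` I) \<longrightarrow> card I > CARD('d))"

definition config_polytope :: "('n::finite \<Rightarrow> real ^ 'd::finite) \<Rightarrow> (real ^ 'n) set" where
  "config_polytope \<Lambda> =
     {x. (\<forall>i. 0 \<le> x $ i) \<and> (\<Sum>i\<in>UNIV. x $ i *\<^sub>R \<Lambda> i) = 0 \<and> (\<Sum>i\<in>UNIV. x $ i) = 1}"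

definition config_face :: "('n::finite \<Rightarrow> real ^ 'd::finite) \<Rightarrow> 'n set \<Rightarrow> (real ^ 'n) set" where
  "config_face \<Lambda> J = config_polytope \<Lambda> \<inter> {x. \<forall>j\<in>J. x $ j = 0}"

end

theory Submission
  imports Defs
begin

text \<open>
  A nonempty convex set has nonempty relative interior, so the left-hand side says that the face
  \<open>F\<^sub>J\<close> is nonempty, that is, \<open>0\<close> is a convex combination of the points with index outside \<open>J\<close>.
  Among the subsets of these points with \<open>0\<close> in their convex hull take one of least cardinality. By
  Caratheodory's theorem it is affinely independent, and by admissibility it has more than \<open>d\<close>
  points, so it spans a \<open>d\<close>-simplex. By minimality all barycentric coordinates of \<open>0\<close> are
  positive, hence \<open>0\<close> is an interior point.
\<close>

text \<open>Version of \<open>convex_hull_finite\<close> for indexed families: points of a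
  configuration may coincide, and the coordinates of a face are weights on indices, not on
  points.\<close>

lemma convex_hull_image_finite_iff:
  fixes f :: "'i \<Rightarrow> 'a::real_vector"
  assumes "finite I"
  shows "y \<in> convex hull (f ` I) \<longleftrightarrow>
    (\<exists>u. (\<forall>i\<in>I. 0 \<le> u i) \<and> sum u I = 1 \<and> (\<Sum>i\<in>I. u i *\<^sub>R f i) = y)"
proof
  assume "y \<in> convex hull (f ` I)"
  \<comment> \<open>\<open>K\<close> picks one index for each value of \<open>f\<close>; that index
    will carry the whole weight of its point, and all other indices get weight 0.\<close>
  moreover obtain K where K: "K \<subseteq> I" "inj_on f K" "f ` I = f ` K"
    using subset_image_inj[of "f ` I" f I] by auto
  moreover have "finite (f ` K)"
    using K assms finite_subset by blast
  ultimately obtain v where v: "\<forall>x\<in>f ` K. 0 \<le> v x" "sum v (f ` K) = 1"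
      "(\<Sum>x\<in>f ` K. v x *\<^sub>R x) = y"
    by (auto simp: convex_hull_finite simp del: finite_imageI)
  define u where "u i = (if i \<in> K then v (f i) else 0)" for i
  have "sum u I = sum u K"
    by (rule sum.mono_neutral_right) (use assms K in \<open>auto simp: u_def\<close>)
  also have "\<dots> = 1"
    using v(2) K(2) by (simp add: u_def sum.reindex)
  finally have "sum u I = 1" .
  moreover have "(\<Sum>i\<in>I. u i *\<^sub>R f i) = (\<Sum>i\<in>K. u i *\<^sub>R f i)"
    by (rule sum.mono_neutral_right) (use assms K in \<open>auto simp: u_def\<close>)
  moreover have "(\<Sum>i\<in>K. u i *\<^sub>R f i) = y"
    using v(3) K(2) by (simp add: u_def sum.reindex)
  moreover have "\<forall>i\<in>I. 0 \<le> u i"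
    using v(1) by (simp add: u_def)
  ultimately show "\<exists>u. (\<forall>i\<in>I. 0 \<le> u i) \<and> sum u I = 1 \<and> (\<Sum>i\<in>I. u i *\<^sub>R f i) = y"
    by auto
next
  assume "\<exists>u. (\<forall>i\<in>I. 0 \<le> u i) \<and> sum u I = 1 \<and> (\<Sum>i\<in>I. u i *\<^sub>R f i) = y"
  then show "y \<in> convex hull (f ` I)"
    using assms by (auto intro!: convex_sum convex_convex_hull intro: hull_inc)
qed

lemma mem_interior_convex_hull_if_no_small_subset:
  fixes S :: "'a::euclidean_space set"
  assumes "y \<in> convex hull S"
    and large: "\<And>T. finite T \<Longrightarrow> T \<subseteq> S \<Longrightarrow> y \<in> convex hull T \<Longrightarrow> DIM('a) < card T"
  shows "y \<in> interior (convex hull S)"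
proof -
  let ?P = "\<lambda>T. finite T \<and> T \<subseteq> S \<and> y \<in> convex hull T"
  \<comment> \<open>\<open>S\<close> may be infinite, so Caratheodory's theorem is used here only to
    find some finite candidate.\<close>
  obtain T0 where "?P T0"
    using assms(1) unfolding caratheodory[of S] by auto
  from ex_has_least_nat[of ?P, OF this, of card]
  obtain T where "?P T" and least: "\<And>T'. ?P T' \<Longrightarrow> card T \<le> card T'"
    by (elim exE conjE) simp
  then have T: "finite T" "T \<subseteq> S" "y \<in> convex hull T"
    by auto
  obtain T' where T': "finite T'" "T' \<subseteq> T" "int (card T') \<le> aff_dim T + 1" "y \<in> convex hull T'"
    using T(3) unfolding caratheodory_aff_dim[of T] by auto
  \<comment> \<open>Minimality of \<open>T\<close> yields
    \<open>card T \<le> card T' \<le> aff_dim T + 1\<close>. As \<open>aff_dim T\<close> is at most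
    \<open>card T - 1\<close>, equality holds, which is affine independence.\<close>
  have "card T \<le> card T'"
    using T' T by (intro least) auto
  then have indep: "\<not> affine_dependent T"
    using T'(3) aff_dim_le_card[OF T(1)] T(1) by (simp add: affine_independent_iff_card)
  obtain u where u: "\<forall>x\<in>T. 0 \<le> u x" "sum u T = 1" "(\<Sum>x\<in>T. u x *\<^sub>R x) = y"
    using T(3) by (auto simp: convex_hull_finite[OF T(1)])
  have "0 < u x" if "x \<in> T" for x
  proof (rule ccontr)
    assume "\<not> 0 < u x"
    with u(1) that have "u x = 0"
      by force
    then have "sum u (T - {x}) = 1" "(\<Sum>z\<in>T - {x}. u z *\<^sub>R z) = y"
      using u T(1) that by (simp_all add: sum_diff1)
    then have "y \<in> convex hull (T - {x})"
      using u(1) T(1) by (auto simp: convex_hull_finite)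
    then have "card T \<le> card (T - {x})"
      using T by (intro least) auto
    then show False
      using card_Diff1_less[OF T(1) that] by simp
  qed
  \<comment> \<open>For affinely independent \<open>T\<close>, the interior of the hull consists of
    the combinations with all weights positive, provided that \<open>T\<close> has more than
    \<open>DIM('a)\<close> points; \<open>large\<close> ensures this.\<close>
  then have "y \<in> interior (convex hull T)"
    using u large[OF T] by (auto simp: interior_convex_hull_explicit_minimal[OF indep])
  then show ?thesis
    using interior_mono[OF hull_mono[OF T(2)]] by blast
qed

lemma convex_config_face: "convex (config_face \<Lambda> J)"
proof (rule convexI)
  fix x y and a b :: real
  assume "x \<in> config_face \<Lambda> J" "y \<in> config_face \<Lambda> J" and ab: "0 \<le> a" "0 \<le> b" "a + b = 1"
  moreover have "(\<Sum>i\<in>UNIV. (a *\<^sub>R x + b *\<^sub>R y) $ i *\<^sub>R \<Lambda> i) =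
      a *\<^sub>R (\<Sum>i\<in>UNIV. x $ i *\<^sub>R \<Lambda> i) + b *\<^sub>R (\<Sum>i\<in>UNIV. y $ i *\<^sub>R \<Lambda> i)"
    by (simp add: scaleR_sum_right scaleR_add_left sum.distrib)
  moreover have "(\<Sum>i\<in>UNIV. (a *\<^sub>R x + b *\<^sub>R y) $ i) =
      a * (\<Sum>i\<in>UNIV. x $ i) + b * (\<Sum>i\<in>UNIV. y $ i)"
    by (simp add: sum_distrib_left sum.distrib)
  ultimately show "a *\<^sub>R x + b *\<^sub>R y \<in> config_face \<Lambda> J"
    by (auto simp: config_face_def config_polytope_def)
qed

text \<open>A point of the face is itself a weight vector expressing 0: restrict it to the
  complement of \<open>J\<close>, or conversely extend weights by zero on \<open>J\<close>.\<close>

lemma config_face_nonempty_iff: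
  "config_face \<Lambda> J \<noteq> {} \<longleftrightarrow> 0 \<in> convex hull (\<Lambda> ` (- J))"
proof
  assume "config_face \<Lambda> J \<noteq> {}"
  then obtain x where x: "\<forall>i. 0 \<le> x $ i" "(\<Sum>i\<in>UNIV. x $ i *\<^sub>R \<Lambda> i) = 0"
      "(\<Sum>i\<in>UNIV. x $ i) = 1" "\<forall>j\<in>J. x $ j = 0"
    by (auto simp: config_face_def config_polytope_def)
  have "(\<Sum>i\<in>- J. x $ i *\<^sub>R \<Lambda> i) = (\<Sum>i\<in>UNIV. x $ i *\<^sub>R \<Lambda> i)"
    "(\<Sum>i\<in>- J. x $ i) = (\<Sum>i\<in>UNIV. x $ i)"
    by (rule sum.mono_neutral_left; use x(4) in auto)+
  with x show "0 \<in> convex hull (\<Lambda> ` (- J))"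
    by (auto simp: convex_hull_image_finite_iff)
next
  assume "0 \<in> convex hull (\<Lambda> ` (- J))"
  then obtain u where u: "\<forall>i\<in>- J. 0 \<le> u i" "sum u (- J) = 1" "(\<Sum>i\<in>- J. u i *\<^sub>R \<Lambda> i) = 0"
    by (auto simp: convex_hull_image_finite_iff)
  define x where "x = (\<chi> i. if i \<in> J then 0 else u i)"
  have "(\<Sum>i\<in>UNIV. x $ i *\<^sub>R \<Lambda> i) = (\<Sum>i\<in>- J. x $ i *\<^sub>R \<Lambda> i)"
    "(\<Sum>i\<in>UNIV. x $ i) = (\<Sum>i\<in>- J. x $ i)"
    by (rule sum.mono_neutral_right; auto simp: x_def)+
  then have "(\<Sum>i\<in>UNIV. x $ i *\<^sub>R \<Lambda> i) = 0" "(\<Sum>i\<in>UNIV. x $ i) = 1"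
    using u by (simp_all add: x_def)
  then have "x \<in> config_face \<Lambda> J"
    using u(1) by (auto simp: config_face_def config_polytope_def x_def)
  then show "config_face \<Lambda> J \<noteq> {}"
    by blast
qed

lemma admissible_zero_mem_interior:
  assumes "admissible \<Lambda>" and "0 \<in> convex hull (\<Lambda> ` I)"
  shows "0 \<in> interior (convex hull (\<Lambda> ` I))"
proof (rule mem_interior_convex_hull_if_no_small_subset[OF assms(2)])
  fix T
  assume "T \<subseteq> \<Lambda> ` I" and "0 \<in> convex hull T"
  \<comment> \<open>Admissibility counts indices, so repeated points must be represented only once.\<close>
  moreover from \<open>T \<subseteq> \<Lambda> ` I\<close> obtain K where "inj_on \<Lambda> K" "T = \<Lambda> ` K"
    by (auto simp: subset_image_inj)
  ultimately show "DIM(real ^ 'b) < card T"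
    using assms(1) by (auto simp: admissible_def card_image)
qed

theorem proposition3p2:
  fixes m :: nat
    and \<Lambda> :: "'n::finite \<Rightarrow> real ^ 'd::finite"
    and J :: "'n set"
  assumes "m \<ge> 1"
    and "CARD('d) = 4 * m"
    and "admissible \<Lambda>"
    and "affine hull (range \<Lambda>) = UNIV"
  shows "rel_interior (config_face \<Lambda> J) \<noteq> {} \<longleftrightarrow>
         0 \<in> rel_interior (convex hull (\<Lambda> ` (- J)))"
proof -
  have "rel_interior (config_face \<Lambda> J) \<noteq> {} \<longleftrightarrow> 0 \<in> convex hull (\<Lambda> ` (- J))"
    by (simp add: rel_interior_eq_empty convex_config_face config_face_nonempty_iff)
  also have "\<dots> \<longleftrightarrow> 0 \<in> rel_interior (convex hull (\<Lambda> ` (- J)))"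
    \<comment> \<open>Interior points are relative interior points, and these lie in the
      hull.\<close>
    using admissible_zero_mem_interior[OF assms(3)] interior_subset_rel_interior
      rel_interior_subset by blast
  finally show ?thesis .
qed

end
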